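(* Consider an ECM-sketch of a stream $a$ whose Count-Min array is configured with parameters $\epsilon_{cm},\delta_{cm}\in(0,1)$ and whose counters are exponential histograms configured with error parameter $\epsilon_{sw}\in(0,1)$. For every item $x$ and every query range $r$ within the sliding window such that $\|a_r\|_1>0$, the probability (over the choice of the hash functions) that $$|\hat f(x,r)-f(x,r)|\ \ge\ (\epsilon_{sw}+\epsilon_{cm}+\epsilon_{sw}\epsilon_{cm})\,\|a_r\|_1$$ is at most $\delta=\delta_{cm}$.
   Context: A stream $a$ is a sequence of item arrivals from a domain $\mathcal D$ (each arrival contributes one unit), fixed independently of the hash functions. A sliding window of length $N$ covers either the last $N$ time units (time-based) or the last $N$ arrivals (count-based). For a query range $r\le N$ (in time units or arrivals, respectively), $a_r$ is the substream of arrivals of $a$ within the last $r$ time units (respectively, last $r$ arrivals), $f(x,r)$ is the number of occurrences of item $x$ in $a_r$, and $\|a_r\|_1$ is the total number of arrivals in $a_r$. ECM-sketch: let $w=\lceil e/\epsilon_{cm}\rceil$ (with $e$ the base of the natural logarithm) and $d=\lceil\ln(1/\delta_{cm})\rceil$. The sketch has $d$ hash functions $h_1,\dots,h_d:\mathcal D\to\{1,\dots,w\}$, drawn independently from a pairwise-independent family, and a $w\times d$ array of sliding-window counters. On each arrival of an item $x$, for every $j\in\{1,\dots,d\}$ the arrival (with its time stamp, or its position in the stream for count-based windows) is registered in counter $(h_j(x),j)$. Let $R(i,j,r)$ be the true number of arrivals within range $r$ registered in counter $(i,j)$, i.e. $R(i,j,r)=\sum_{y\in\mathcal D:\,h_j(y)=i}f(y,r)$.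 Each counter is an exponential histogram with error parameter $\epsilon_{sw}$: a deterministic structure whose nonnegative estimate $E(i,j,r)$ satisfies, for every range $r$ within the window, $|E(i,j,r)-R(i,j,r)|\le\epsilon_{sw}R(i,j,r)$. The point-query estimate is $\hat f(x,r)=\min_{1\le j\le d}E(h_j(x),j,r)$. *)

theory Defs
  imports "HOL-Probability.Probability"
begin

section \<open>Streams and sliding windows\<close>

text \<open>A stream lists the arrivals seen so far, oldest first, as pairs (arrival time, item).\<close>

type_synonym 'd stream = "(real \<times> 'd) list"

definition stream_until :: "real \<Rightarrow> 'd stream \<Rightarrow> bool" where
  "stream_until now a \<longleftrightarrow> sorted (map fst a) \<and> (\<forall>t \<in> set (map fst a). t \<le> now)"

text \<open>Window lengths and query ranges: the constructor records whether the length is measured in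
  time units (time-based windows) or in arrivals (count-based windows).\<close>

datatype extent = Time real | Arrivals nat

fun within_window :: "extent \<Rightarrow> extent \<Rightarrow> bool" where
  "within_window (Time r) (Time N) \<longleftrightarrow> 0 \<le> r \<and> r \<le> N"
| "within_window (Arrivals r) (Arrivals N) \<longleftrightarrow> r \<le> N"
| "within_window _ _ \<longleftrightarrow> False"

text \<open>The substream $a_r$. The last \<open>r\<close> time units are the half-open interval
  \<open>{now - r<..now}\<close>.\<close>

fun substream :: "real \<Rightarrow> 'd stream \<Rightarrow> extent \<Rightarrow> 'd stream" where
  "substream now a (Time r) = filter (\<lambda>(t, y). now - r < t \<and> t \<le> now) a"
| "substream now a (Arrivals r) = drop (length a - r) a"

definition freq :: "real \<Rightarrow> 'd stream \<Rightarrow> 'd \<Rightarrow> extent \<Rightarrow> nat" where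
  "freq now a x r = count_list (map snd (substream now a r)) x"

definition l1_norm :: "real \<Rightarrow> 'd stream \<Rightarrow> extent \<Rightarrow> nat" where
  "l1_norm now a r = length (substream now a r)"


section \<open>Sliding-window counters\<close>

text \<open>A counter only sees the stamps of the arrivals registered in it: arrival times for time-based
  windows, and positions \<open>1, 2, \<dots>\<close> in the whole stream for count-based ones. The current stamp is
  the current time, respectively the number of arrivals in the whole stream.\<close>

fun stamped :: "extent \<Rightarrow> 'd stream \<Rightarrow> (real \<times> 'd) list" where
  "stamped (Time N) a = a"
| "stamped (Arrivals N) a = zip (map real [1..<Suc (length a)]) (map snd a)"

fun current_stamp :: "extent \<Rightarrow> real \<Rightarrow> 'd stream \<Rightarrow> real" where
  "current_stamp (Time N) now a = now"
| "current_stamp (Arrivals N) now a = real (length a)"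

fun extent_length :: "extent \<Rightarrow> real" where
  "extent_length (Time r) = r"
| "extent_length (Arrivals r) = real r"

definition count_in_range :: "real list \<Rightarrow> real \<Rightarrow> extent \<Rightarrow> nat" where
  "count_in_range S T r = length (filter (\<lambda>s. T - extent_length r < s \<and> s \<le> T) S)"

text \<open>The stamp sequences \<open>S\<close> that a counter can have received when the current stamp is \<open>T\<close>.\<close>

fun counter_history :: "extent \<Rightarrow> real list \<Rightarrow> real \<Rightarrow> bool" where
  "counter_history (Time N) S T \<longleftrightarrow> sorted S \<and> (\<forall>s \<in> set S. s \<le> T)"
| "counter_history (Arrivals N) S T \<longleftrightarrow>
     (\<exists>n P. P \<subseteq> {1..n} \<and> T = real n \<and> S = map real (sorted_list_of_set P))"

text \<open>An exponential histogram is represented by its query answers: \<open>est S T r\<close> is the answer for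
  query range \<open>r\<close> at current stamp \<open>T\<close> after the stamps \<open>S\<close> have been registered. That \<open>est\<close> is a
  function expresses that the structure is deterministic.\<close>

definition exponential_histogram ::
    "extent \<Rightarrow> real \<Rightarrow> (real list \<Rightarrow> real \<Rightarrow> extent \<Rightarrow> real) \<Rightarrow> bool" where
  "exponential_histogram N \<epsilon> est \<longleftrightarrow>
     (\<forall>S T r. counter_history N S T \<and> within_window r N \<longrightarrow>
        0 \<le> est S T r \<and>
        \<bar>est S T r - real (count_in_range S T r)\<bar> \<le> \<epsilon> * real (count_in_range S T r))"


section \<open>Hash functions\<close>

text \<open>A family of hash functions into \<open>{1..w}\<close> is given by the distribution of a randomly drawn
  member. The hash value of each item is uniform, and those of two distinct items are independent.
  For a finite family \<open>F\<close> can be the uniform measure on it; general measures are allowed since on an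
  infinite item domain no distribution with atoms has these properties unless \<open>w = 1\<close>.\<close>

definition pairwise_independent_family :: "nat \<Rightarrow> ('d \<Rightarrow> nat) measure \<Rightarrow> bool" where
  "pairwise_independent_family w F \<longleftrightarrow>
     prob_space F \<and>
     (\<forall>x. (\<lambda>h. h x) \<in> F \<rightarrow>\<^sub>M count_space {1..w}) \<and>
     (\<forall>x. distr F (count_space {1..w}) (\<lambda>h. h x) = uniform_count_measure {1..w}) \<and>
     (\<forall>x y. x \<noteq> y \<longrightarrow>
        prob_space.indep_var F (count_space {1..w}) (\<lambda>h. h x) (count_space {1..w}) (\<lambda>h. h y))"


section \<open>ECM-sketches\<close>

definition ecm_width :: "real \<Rightarrow> nat" where
  "ecm_width \<epsilon> = nat \<lceil>exp 1 / \<epsilon>\<rceil>"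

definition ecm_depth :: "real \<Rightarrow> nat" where
  "ecm_depth \<delta> = nat \<lceil>ln (1 / \<delta>)\<rceil>"

text \<open>The \<open>d\<close> hash functions, indexed by \<open>{1..d}\<close>, are drawn independently from the family.\<close>

definition hash_space :: "nat \<Rightarrow> ('d \<Rightarrow> nat) measure \<Rightarrow> (nat \<Rightarrow> 'd \<Rightarrow> nat) measure" where
  "hash_space d F = PiM {1..d} (\<lambda>_. F)"

definition registered ::
    "extent \<Rightarrow> 'd stream \<Rightarrow> (nat \<Rightarrow> 'd \<Rightarrow> nat) \<Rightarrow> nat \<Rightarrow> nat \<Rightarrow> real list" where
  "registered N a h i j = map fst (filter (\<lambda>(s, y). h j y = i) (stamped N a))"

text \<open>The estimate $E(i,j,r)$ of counter $(i,j)$.\<close>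

definition counter_estimate ::
    "(real list \<Rightarrow> real \<Rightarrow> extent \<Rightarrow> real) \<Rightarrow> extent \<Rightarrow> real \<Rightarrow> 'd stream \<Rightarrow>
     (nat \<Rightarrow> 'd \<Rightarrow> nat) \<Rightarrow> nat \<Rightarrow> nat \<Rightarrow> extent \<Rightarrow> real" where
  "counter_estimate est N now a h i j r =
     est (registered N a h i j) (current_stamp N now a) r"

definition point_query ::
    "(real list \<Rightarrow> real \<Rightarrow> extent \<Rightarrow> real) \<Rightarrow> nat \<Rightarrow> extent \<Rightarrow> real \<Rightarrow> 'd stream \<Rightarrow>
     (nat \<Rightarrow> 'd \<Rightarrow> nat) \<Rightarrow> 'd \<Rightarrow> extent \<Rightarrow> real" where
  "point_query est d N now a h x r =
     Min ((\<lambda>j. counter_estimate est N now a h (h j x) j r) ` {1..d})"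

end

theory Submission
  imports Defs
begin

text \<open>Let \<open>C\<^sub>j\<close> count the arrivals in range of items other than \<open>x\<close> that collide with \<open>x\<close> under
  \<open>h\<^sub>j\<close>, so that the counter of \<open>x\<close> in row \<open>j\<close> has true value \<open>f + C\<^sub>j\<close>. Every estimate is at least
  \<open>(1 - \<epsilon>\<^sub>s\<^sub>w) f\<close>, so a large error must be an overestimate in every row, and
  \<open>(1 + \<epsilon>\<^sub>s\<^sub>w) (f + C\<^sub>j) - f \<ge> (\<epsilon>\<^sub>s\<^sub>w + \<epsilon>\<^sub>c\<^sub>m + \<epsilon>\<^sub>s\<^sub>w \<epsilon>\<^sub>c\<^sub>m) L\<close> forces \<open>C\<^sub>j \<ge> \<epsilon>\<^sub>c\<^sub>m L\<close> because \<open>f \<le> L\<close>. As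
  \<open>C\<^sub>j\<close> has mean at most \<open>L / w \<le> \<epsilon>\<^sub>c\<^sub>m L / e\<close>, Markov's inequality bounds the probability of this
  by \<open>1 / e\<close> per row, and the \<open>d \<ge> ln (1 / \<delta>\<^sub>c\<^sub>m)\<close> rows are independent.\<close>

section \<open>Counter contents in both window models\<close>

text \<open>Expressing stamp and item through the position \<open>k\<close> lets filters on the
  zipped list act on \<open>upt\<close> alone. Stamps count from 1 and list indices from 0, hence
  \<open>k - 1\<close>.\<close>

lemma zip_upt_conv_map:
  "zip (map f [1..<Suc (length xs)]) (map g xs) = map (\<lambda>k. (f k, g (xs ! (k - 1)))) [1..<Suc (length xs)]"
  by (rule nth_equalityI) (auto simp del: upt_Suc)

text \<open>Makes the guarantee of \<open>exponential_histogram\<close> applicable to every counter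
  of the sketch. Filtering preserves sortedness; in the count-based case the positions hashed to
  \<open>i\<close> serve as the set \<open>P\<close>.\<close>

lemma counter_history_registered:
  assumes "stream_until now a"
  shows "counter_history N (registered N a h i j) (current_stamp N now a)"
proof (cases N)
  case (Time n)
  then show ?thesis
    using assms by (auto simp: registered_def stream_until_def intro: sorted_filter)
next
  case (Arrivals n)
  define Q where "Q = (\<lambda>k. h j (snd (a ! (k - 1))) = i)"
  have "registered N a h i j = map real (filter Q [1..<Suc (length a)])"
    unfolding registered_def Arrivals stamped.simps zip_upt_conv_map
    by (simp add: filter_map o_def Q_def del: upt_Suc)
  also have "filter Q [1..<Suc (length a)] = sorted_list_of_set (set (filter Q [1..<Suc (length a)]))"
    by (rule sorted_list_of_set.idem_if_sorted_distinct [symmetric])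
       (auto simp del: upt_Suc intro: sorted_wrt_filter)
  finally have "registered N a h i j =
      map real (sorted_list_of_set (set (filter Q [1..<Suc (length a)])))" .
  then show ?thesis
    by (auto simp: Arrivals simp del: upt_Suc intro!: exI[of _ "length a"]
        exI[of _ "set (filter Q [1..<Suc (length a)])"])
qed

lemma filter_stamped_arrivals:
  "map snd (filter (\<lambda>(s, y). real (length a) - real r < s \<and> s \<le> real (length a))
     (zip (map real [1..<Suc (length a)]) (map snd a))) = map snd (drop (length a - r) a)"
proof -
  let ?n = "length a"
  \<comment> \<open>If \<open>r\<close> exceeds \<open>?n\<close>, the natural subtraction truncates
    to 0 while the real one is negative; \<open>0 < k\<close> makes the two tests agree.\<close>
  have less_iff: "real ?n - real r < real k \<longleftrightarrow> ?n - r < k" if "0 < k" for k :: nat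
    using that by linarith
  \<comment> \<open>The cut is after position \<open>?n - r\<close>: the filter rejects all of the
    first block and keeps all of the second.\<close>
  have split: "[1..<Suc ?n] = [1..<Suc (?n - r)] @ [Suc (?n - r)..<Suc ?n]"
    using upt_add_eq_append[of 1 "Suc (?n - r)" "?n - (?n - r)"] by (simp del: upt_Suc)
  have "filter (\<lambda>k. real ?n - real r < real k \<and> real k \<le> real ?n) [1..<Suc ?n]
      = filter (\<lambda>k. ?n - r < k) [1..<Suc ?n]"
    by (rule filter_cong) (auto simp: less_iff simp del: upt_Suc)
  also have "\<dots> = [Suc (?n - r)..<Suc ?n]"
    unfolding split by (auto simp del: upt_Suc simp: filter_empty_conv filter_id_conv)
  finally have "filter (\<lambda>k. real ?n - real r < real k \<and> real k \<le> real ?n) [1..<Suc ?n]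
      = [Suc (?n - r)..<Suc ?n]" .
  then show ?thesis
    unfolding zip_upt_conv_map
    by (auto simp: filter_map o_def simp del: upt_Suc intro!: nth_equalityI)
qed

text \<open>Selecting by hash value and selecting by stamp commute, so the true value of a counter
  can be read off the substream. \<open>within_window\<close> forces \<open>r\<close> and
  \<open>N\<close> to use the same unit.\<close>

lemma count_in_range_registered:
  assumes "within_window r N"
  shows "count_in_range (registered N a h i j) (current_stamp N now a) r
       = length (filter (\<lambda>y. h j y = i) (map snd (substream now a r)))"
proof -
  let ?T = "current_stamp N now a"
  have "count_in_range (registered N a h i j) ?T r
      = length (filter (\<lambda>y. h j y = i)
          (map snd (filter (\<lambda>(s, y). ?T - extent_length r < s \<and> s \<le> ?T) (stamped N a))))"
    unfolding count_in_range_def registered_def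
    by (simp add: filter_map o_def case_prod_beta conj_ac)
  also have "map snd (filter (\<lambda>(s, y). ?T - extent_length r < s \<and> s \<le> ?T) (stamped N a))
      = map snd (substream now a r)"
  proof (cases N)
    case (Time n)
    with assms show ?thesis by (cases r) auto
  next
    case (Arrivals n)
    with assms show ?thesis
      by (cases r) (auto simp: filter_stamped_arrivals simp del: upt_Suc One_nat_def)
  qed
  finally show ?thesis .
qed

section \<open>Collisions under a pairwise independent family\<close>

text \<open>With \<open>g = h j\<close> and \<open>ys\<close> the items in range, this is
  \<open>C\<^sub>j\<close>, counted with multiplicity.\<close>

definition collisions :: "'d list \<Rightarrow> 'd \<Rightarrow> ('d \<Rightarrow> 'b) \<Rightarrow> nat" where
  "collisions ys x g = length (filter (\<lambda>y. y \<noteq> x \<and> g y = g x) ys)"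

lemma length_filter_hash_eq:
  "length (filter (\<lambda>y. g y = g x) ys) = count_list ys x + collisions ys x g"
  by (induction ys) (auto simp: collisions_def)

text \<open>The probability is that of a point under the uniform distribution on
  \<open>{1..w}\<close>. For \<open>i\<close> outside this range the fibre is empty, hence still an
  event.\<close>

lemma hash_fiber:
  assumes "pairwise_independent_family w F"
  shows "{h \<in> space F. h x = i} \<in> sets F"
    and "i \<in> {1..w} \<Longrightarrow> measure F {h \<in> space F. h x = i} = 1 / w"
proof -
  have meas: "(\<lambda>h. h x) \<in> F \<rightarrow>\<^sub>M count_space {1..w}"
    and distr: "distr F (count_space {1..w}) (\<lambda>h. h x) = uniform_count_measure {1..w}"
    using assms by (auto simp: pairwise_independent_family_def)
  have eq: "{h \<in> space F. h x = i} = (\<lambda>h. h x) -` {i} \<inter> space F" for i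
    by auto
  show "{h \<in> space F. h x = i} \<in> sets F"
  proof (cases "i \<in> {1..w}")
    case True
    then show ?thesis unfolding eq using meas by (auto intro: measurable_sets)
  next
    case False
    then have "{h \<in> space F. h x = i} = {}"
      using measurable_space[OF meas] by auto
    with sets.empty_sets show ?thesis by (simp only:)
  qed
  assume i: "i \<in> {1..w}"
  have "measure F {h \<in> space F. h x = i} = measure (distr F (count_space {1..w}) (\<lambda>h. h x)) {i}"
    unfolding eq using meas i by (subst measure_distr) auto
  also have "\<dots> = 1 / w"
    unfolding distr using i by (subst measure_uniform_count_measure) auto
  finally show "measure F {h \<in> space F. h x = i} = 1 / w" .
qed

text \<open>Splitting by the common hash value gives \<open>w\<close> disjoint events, each of
  probability \<open>1 / w * (1 / w)\<close> by independence.\<close>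

lemma collision_probability:
  assumes "pairwise_independent_family w F" "x \<noteq> y"
  shows "{h \<in> space F. h y = h x} \<in> sets F"
    and "measure F {h \<in> space F. h y = h x} = 1 / w"
proof -
  interpret prob_space F
    using assms by (simp add: pairwise_independent_family_def)
  have meas: "(\<lambda>h. h x) \<in> F \<rightarrow>\<^sub>M count_space {1..w}"
    and indep: "indep_var (count_space {1..w}) (\<lambda>h. h y) (count_space {1..w}) (\<lambda>h. h x)"
    using assms by (auto simp: pairwise_independent_family_def)
  let ?A = "\<lambda>x i. {h \<in> space F. h x = i}"
  have eq: "{h \<in> space F. h y = h x} = (\<Union>i\<in>{1..w}. ?A y i \<inter> ?A x i)"
    using measurable_space[OF meas] by auto
  have sets: "?A z i \<in> sets F" for z i
    by (rule hash_fiber[OF assms(1)])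
  show "{h \<in> space F. h y = h x} \<in> sets F"
    unfolding eq using sets by auto
  have "measure F {h \<in> space F. h y = h x} = (\<Sum>i\<in>{1..w}. measure F (?A y i \<inter> ?A x i))"
    unfolding eq using sets by (intro finite_measure_finite_Union) (auto simp: disjoint_family_on_def)
  also have "\<dots> = (\<Sum>i\<in>{1..w}. 1 / w * (1 / w))"
  proof (rule sum.cong)
    fix i assume i: "i \<in> {1..w}"
    have "measure F (?A y i \<inter> ?A x i)
        = prob ((\<lambda>h. (h y, h x)) -` ({i} \<times> {i}) \<inter> space F)"
      by (rule arg_cong[where f = prob]) auto
    also have "\<dots> = prob ((\<lambda>h. h y) -` {i} \<inter> space F) * prob ((\<lambda>h. h x) -` {i} \<inter> space F)"
      using i by (intro indep_varD[OF indep]) auto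
    also have "\<dots> = measure F (?A y i) * measure F (?A x i)"
      by (intro arg_cong2[where f = "(*)"] arg_cong[where f = prob]) auto
    also have "\<dots> = 1 / w * (1 / w)"
      using hash_fiber(2)[OF assms(1) i] by simp
    finally show "measure F (?A y i \<inter> ?A x i) = 1 / w * (1 / w)" .
  qed simp
  also have "\<dots> = 1 / w"
    by simp
  finally show "measure F {h \<in> space F. h y = h x} = 1 / w" .
qed

text \<open>Linearity of expectation along \<open>ys\<close>: an arrival of an item other than
  \<open>x\<close> contributes \<open>1 / w\<close>, an arrival of \<open>x\<close> contributes
  0.\<close>

lemma expected_collisions:
  assumes "pairwise_independent_family w F"
  shows "integrable F (\<lambda>h. real (collisions ys x h))"
    and "(\<integral>h. real (collisions ys x h) \<partial>F) \<le> length ys / w"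
proof -
  interpret prob_space F
    using assms by (simp add: pairwise_independent_family_def)
  \<comment> \<open>Both claims go through one induction, since splitting the integral of the sum
    requires integrability of the tail.\<close>
  have "integrable F (\<lambda>h. real (collisions ys x h)) \<and>
      (\<integral>h. real (collisions ys x h) \<partial>F) \<le> length ys / w"
  proof (induction ys)
    case Nil
    show ?case by (simp add: collisions_def)
  next
    case (Cons y ys)
    show ?case
    proof (cases "y = x")
      case True
      then have "collisions (y # ys) x h = collisions ys x h" for h :: "'a \<Rightarrow> nat"
        by (simp add: collisions_def)
      moreover have "length ys / w \<le> length (y # ys) / w"
        by (intro divide_right_mono) auto
      ultimately show ?thesis using Cons by simp
    next
      case False
      let ?C = "{h \<in> space F. h y = h x}"
      have C: "?C \<in> sets F" "measure F ?C = 1 / w"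
        using collision_probability[OF assms, of x y] False by auto
      \<comment> \<open>The restriction to \<open>space F\<close> is needed because
        \<open>?C\<close> contains only such \<open>h\<close>.\<close>
      have step: "real (collisions (y # ys) x h) = indicator ?C h + real (collisions ys x h)"
        if "h \<in> space F" for h
        using that False by (simp add: collisions_def indicator_def)
      have int: "integrable F (\<lambda>h. indicator ?C h + real (collisions ys x h))"
        using C Cons by (intro Bochner_Integration.integrable_add) (auto simp: less_top[symmetric])
      have int': "integrable F (\<lambda>h. real (collisions (y # ys) x h))"
        using int by (subst Bochner_Integration.integrable_cong[OF refl step]) auto
      have "(\<integral>h. real (collisions (y # ys) x h) \<partial>F)
          = (\<integral>h. indicator ?C h + real (collisions ys x h) \<partial>F)"
        by (intro Bochner_Integration.integral_cong step) auto
      also have "\<dots> = 1 / w + (\<integral>h. real (collisions ys x h) \<partial>F)"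
        using C Cons by (subst Bochner_Integration.integral_add) (auto simp: less_top[symmetric])
      also have "\<dots> \<le> 1 / w + length ys / w"
        using Cons by simp
      also have "\<dots> = length (y # ys) / w"
        by (simp add: add_divide_distrib)
      finally have "(\<integral>h. real (collisions (y # ys) x h) \<partial>F) \<le> length (y # ys) / w" .
      with int' show ?thesis ..
    qed
  qed
  then show "integrable F (\<lambda>h. real (collisions ys x h))"
    and "(\<integral>h. real (collisions ys x h) \<partial>F) \<le> length ys / w"
    by auto
qed

text \<open>The width is chosen for this bound: in Markov's inequality the length of
  \<open>ys\<close> cancels, leaving \<open>1 / (\<epsilon> * w)\<close> for the width
  \<open>w\<close>, and rounding up ensures \<open>\<epsilon> * w \<ge> exp 1\<close>.\<close>

lemma many_collisions_probability:
  assumes "pairwise_independent_family (ecm_width \<epsilon>) F" "0 < \<epsilon>" "ys \<noteq> []"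
  shows "{h \<in> space F. \<epsilon> * length ys \<le> real (collisions ys x h)} \<in> sets F"
    and "measure F {h \<in> space F. \<epsilon> * length ys \<le> real (collisions ys x h)} \<le> exp (-1)"
proof -
  interpret prob_space F
    using assms by (simp add: pairwise_independent_family_def)
  note E = expected_collisions[OF assms(1), of ys x]
  have [measurable]: "(\<lambda>h. real (collisions ys x h)) \<in> borel_measurable F"
    using E(1) by auto
  show "{h \<in> space F. \<epsilon> * length ys \<le> real (collisions ys x h)} \<in> sets F"
    by measurable
  have L: "0 < real (length ys)"
    using assms by simp
  have w: "exp 1 / \<epsilon> \<le> real (ecm_width \<epsilon>)"
    unfolding ecm_width_def by (rule real_nat_ceiling_ge)
  have "measure F {h \<in> space F. \<epsilon> * length ys \<le> real (collisions ys x h)}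
      \<le> (\<integral>h. real (collisions ys x h) \<partial>F) / (\<epsilon> * length ys)"
    using L assms E by (intro integral_Markov_inequality_measure[where A = "{}"]) auto
  also have "\<dots> \<le> (length ys / ecm_width \<epsilon>) / (\<epsilon> * length ys)"
    using L assms E by (intro divide_right_mono) auto
  also have "\<dots> = 1 / (\<epsilon> * ecm_width \<epsilon>)"
    using L by simp
  also have "\<dots> \<le> 1 / exp 1"
  proof (rule divide_left_mono)
    show w': "exp 1 \<le> \<epsilon> * ecm_width \<epsilon>"
      using w assms by (simp add: field_simps)
    show "0 < \<epsilon> * ecm_width \<epsilon> * exp 1"
      by (intro mult_pos_pos order.strict_trans2[OF _ w']) auto
  qed simp
  finally show "measure F {h \<in> space F. \<epsilon> * length ys \<le> real (collisions ys x h)} \<le> exp (-1)"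
    by (simp add: exp_minus inverse_eq_divide)
qed

section \<open>Error of the minimum over independent rows\<close>

theorem theorem1:
  fixes \<epsilon>\<^sub>c\<^sub>m \<delta>\<^sub>c\<^sub>m \<epsilon>\<^sub>s\<^sub>w :: real
    and N r :: extent
    and now :: real
    and a :: "'d stream"
    and est :: "real list \<Rightarrow> real \<Rightarrow> extent \<Rightarrow> real"
    and F :: "('d \<Rightarrow> nat) measure"
    and x :: 'd
  assumes "0 < \<epsilon>\<^sub>c\<^sub>m" "\<epsilon>\<^sub>c\<^sub>m < 1" "0 < \<delta>\<^sub>c\<^sub>m" "\<delta>\<^sub>c\<^sub>m < 1" "0 < \<epsilon>\<^sub>s\<^sub>w" "\<epsilon>\<^sub>s\<^sub>w < 1"
    and "stream_until now a"
    and "pairwise_independent_family (ecm_width \<epsilon>\<^sub>c\<^sub>m) F"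
    and "exponential_histogram N \<epsilon>\<^sub>s\<^sub>w est"
    and "within_window r N"
    and "l1_norm now a r > 0"
  shows "measure (hash_space (ecm_depth \<delta>\<^sub>c\<^sub>m) F)
           {h \<in> space (hash_space (ecm_depth \<delta>\<^sub>c\<^sub>m) F).
              \<bar>point_query est (ecm_depth \<delta>\<^sub>c\<^sub>m) N now a h x r - real (freq now a x r)\<bar>
                \<ge> (\<epsilon>\<^sub>s\<^sub>w + \<epsilon>\<^sub>c\<^sub>m + \<epsilon>\<^sub>s\<^sub>w * \<epsilon>\<^sub>c\<^sub>m) * real (l1_norm now a r)}
         \<le> \<delta>\<^sub>c\<^sub>m"
proof -
  interpret F: prob_space F
    using assms by (simp add: pairwise_independent_family_def)
  define d where "d = ecm_depth \<delta>\<^sub>c\<^sub>m"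
  interpret P: finite_product_prob_space "\<lambda>_. F" "{1..d}"
    by unfold_locales auto
  define ys where "ys = map snd (substream now a r)"
  define f where "f = real (freq now a x r)"
  define L where "L = real (l1_norm now a r)"
  define B where "B = {h \<in> space F. \<epsilon>\<^sub>c\<^sub>m * length ys \<le> real (collisions ys x h)}"
  have L: "L = length ys"
    by (simp add: L_def ys_def l1_norm_def)
  have L_pos: "0 < L"
    using assms by (simp add: L_def)
  have f_le: "f \<le> L"
    unfolding L f_def ys_def freq_def using count_le_length[of "map snd (substream now a r)" x] by auto
  have ln_le: "ln (1 / \<delta>\<^sub>c\<^sub>m) \<le> real d"
    unfolding d_def ecm_depth_def by (rule real_nat_ceiling_ge)
  \<comment> \<open>\<open>\<delta>\<^sub>c\<^sub>m < 1\<close> guarantees at least one row, so that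
    \<open>Min\<close> ranges over a nonempty set.\<close>
  moreover have "0 < ln (1 / \<delta>\<^sub>c\<^sub>m)"
    using assms by (intro ln_gt_zero) simp
  ultimately have d_pos: "0 < d"
    by linarith
  have ys: "ys \<noteq> []"
    using L L_pos by auto
  have B: "B \<in> sets F" "measure F B \<le> exp (-1)"
    unfolding B_def by (rule many_collisions_probability[OF assms(8) assms(1) ys])+
  \<comment> \<open>Covering the error event by a box yields an event of product form, whose measure
    factors over the rows. Monotonicity asks for measurability of the box only.\<close>
  have "h \<in> ({1..d} \<rightarrow>\<^sub>E B)"
    if h: "h \<in> space (hash_space d F)"
      and err: "\<bar>point_query est d N now a h x r - f\<bar> \<ge> (\<epsilon>\<^sub>s\<^sub>w + \<epsilon>\<^sub>c\<^sub>m + \<epsilon>\<^sub>s\<^sub>w * \<epsilon>\<^sub>c\<^sub>m) * L" for h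
  proof -
    define E where "E j = counter_estimate est N now a h (h j x) j r" for j
    define C where "C j = real (collisions ys x (h j))" for j
    have E: "\<bar>E j - (f + C j)\<bar> \<le> \<epsilon>\<^sub>s\<^sub>w * (f + C j)" for j
    proof -
      have "real (count_in_range (registered N a h (h j x) j) (current_stamp N now a) r) = f + C j"
        unfolding count_in_range_registered[OF assms(10)] length_filter_hash_eq
        by (simp add: f_def C_def ys_def freq_def)
      then show ?thesis
        using assms(9,10) counter_history_registered[OF assms(7), of N h "h j x" j]
        unfolding exponential_histogram_def E_def counter_estimate_def by metis
    qed
    have pq: "point_query est d N now a h x r = Min (E ` {1..d})"
      by (simp add: point_query_def E_def)
    have "(1 - \<epsilon>\<^sub>s\<^sub>w) * f \<le> E j" for j
    proof -
      have "(1 - \<epsilon>\<^sub>s\<^sub>w) * f \<le> (1 - \<epsilon>\<^sub>s\<^sub>w) * (f + C j)"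
        using assms by (intro mult_left_mono) (auto simp: C_def)
      also have "\<dots> \<le> E j"
        using E[of j] by (simp add: algebra_simps)
      finally show ?thesis .
    qed
    then have "(1 - \<epsilon>\<^sub>s\<^sub>w) * f \<le> Min (E ` {1..d})"
      using d_pos by (subst Min_ge_iff) auto
    then have "f - Min (E ` {1..d}) \<le> \<epsilon>\<^sub>s\<^sub>w * f"
      by (simp add: algebra_simps)
    also have "\<dots> \<le> \<epsilon>\<^sub>s\<^sub>w * L"
      using f_le assms by (intro mult_left_mono) auto
    \<comment> \<open>Strictness, from \<open>\<epsilon>\<^sub>c\<^sub>m * L > 0\<close>, rules out
      the negative branch of the absolute value in \<open>err\<close>.\<close>
    also have "\<dots> < (\<epsilon>\<^sub>s\<^sub>w + \<epsilon>\<^sub>c\<^sub>m + \<epsilon>\<^sub>s\<^sub>w * \<epsilon>\<^sub>c\<^sub>m) * L"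
      using L_pos assms by (intro mult_strict_right_mono) (auto intro: add_pos_pos)
    finally have over: "Min (E ` {1..d}) - f \<ge> (\<epsilon>\<^sub>s\<^sub>w + \<epsilon>\<^sub>c\<^sub>m + \<epsilon>\<^sub>s\<^sub>w * \<epsilon>\<^sub>c\<^sub>m) * L"
      using err unfolding pq by linarith
    have "h j \<in> B" if j: "j \<in> {1..d}" for j
    proof -
      have "Min (E ` {1..d}) \<le> E j"
        using j by (intro Min_le) auto
      then have "(\<epsilon>\<^sub>s\<^sub>w + \<epsilon>\<^sub>c\<^sub>m + \<epsilon>\<^sub>s\<^sub>w * \<epsilon>\<^sub>c\<^sub>m) * L \<le> (1 + \<epsilon>\<^sub>s\<^sub>w) * (f + C j) - f"
        using over E[of j] by (simp add: algebra_simps)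
      moreover have "\<epsilon>\<^sub>s\<^sub>w * f \<le> \<epsilon>\<^sub>s\<^sub>w * L"
        using f_le assms by (intro mult_left_mono) auto
      \<comment> \<open>The threshold equals \<open>\<epsilon>\<^sub>s\<^sub>w * L + (1 +
        \<epsilon>\<^sub>s\<^sub>w) * (\<epsilon>\<^sub>c\<^sub>m * L)\<close>, and the right-hand
        side of the previous bound is \<open>\<epsilon>\<^sub>s\<^sub>w * f + (1 +
        \<epsilon>\<^sub>s\<^sub>w) * C j\<close>; the first summands are compared through
        \<open>f \<le> L\<close>.\<close>
      ultimately have "(1 + \<epsilon>\<^sub>s\<^sub>w) * (\<epsilon>\<^sub>c\<^sub>m * L) \<le> (1 + \<epsilon>\<^sub>s\<^sub>w) * C j"
        by (simp add: algebra_simps)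
      then have "\<epsilon>\<^sub>c\<^sub>m * L \<le> C j"
        using assms by (simp add: mult_le_cancel_left)
      moreover have "h j \<in> space F"
        using h j by (auto simp: hash_space_def space_PiM)
      ultimately show ?thesis
        by (simp add: B_def C_def L)
    qed
    then show ?thesis
      using h by (auto simp: hash_space_def space_PiM PiE_iff)
  qed
  then have "measure (hash_space d F) {h \<in> space (hash_space d F).
        \<bar>point_query est d N now a h x r - f\<bar> \<ge> (\<epsilon>\<^sub>s\<^sub>w + \<epsilon>\<^sub>c\<^sub>m + \<epsilon>\<^sub>s\<^sub>w * \<epsilon>\<^sub>c\<^sub>m) * L}
      \<le> measure (hash_space d F) ({1..d} \<rightarrow>\<^sub>E B)"
    unfolding hash_space_def using B by (intro P.finite_measure_mono sets_PiM_I_finite) auto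
  \<comment> \<open>Independence of the rows enters here, as the product form of
    \<open>hash_space\<close>.\<close>
  also have "\<dots> = (\<Prod>j\<in>{1..d}. measure F B)"
    unfolding hash_space_def using B by (intro P.finite_measure_PiM_emb) auto
  also have "\<dots> \<le> exp (-1) ^ d"
    using B by (auto intro: power_mono)
  also have "\<dots> = exp (- real d)"
    by (simp add: exp_of_nat_mult[symmetric])
  also have "\<dots> \<le> exp (- ln (1 / \<delta>\<^sub>c\<^sub>m))"
    using ln_le by simp
  also have "\<dots> = \<delta>\<^sub>c\<^sub>m"
    using assms by (simp add: ln_div)
  finally show ?thesis
    by (simp add: d_def f_def L_def)
qed

end
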